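(* Let $d\ge1$ and let $X=\{X_n\}$ be a discrete-time, irreducible, nearest-neighbor random walk on $\mathbb Z^d$ with random transition probabilities $p(x,y):\Omega\to[0,1]$, having a (random) invariant measure $\mu$. Write $\mu(x)=e^{-V(x)}$, $x\in\mathbb Z^d$, with $V(0)=0$, and extend $V$ to a random continuous function $V:\mathbb R^d\to\mathbb R$. Assume that there exist $\alpha>0$ and a random variable $W:\Omega\to C(\mathbb R^d,\mathbb R)$ such that $\lambda^{-\alpha}V(\lambda\,\cdot)$ converges in law to $W(\cdot)$ in $C(\mathbb R^d,\mathbb R)$ as $\lambda\uparrow\infty$. If almost surely there is $a>0$ such that the connected component of the origin in $\{x\in\mathbb R^d:W(x)<a\}$ is bounded, then $X$ is almost surely recurrent.
   Context: $\Omega$ is the probability space of the environment. Nearest-neighbor means that $p(x,y)>0$ only if $\Vert x-y\Vert=1$ (Euclidean norm). An invariant measure satisfies $\mu(x)>0$ and $\sum_{x}\mu(x)p(x,y)=\mu(y)$ for all $y\in\mathbb Z^d$. $C(\mathbb R^d,\mathbb R)$ is the space of continuous functions from $\mathbb R^d$ to $\mathbb R$ with the topology of uniform convergence on compact sets, and convergence in law is with respect to this topology. "Almost surely recurrent" means that for almost every environment the walk with transition probabilities $p(\cdot,\cdot)$ is recurrent. No reversibility is assumed. The value $a$ may depend on the realization. *)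

theory Defs
  imports "HOL-Probability.Probability"
begin

section \<open>The space of continuous functions with locally uniform convergence\<close>

typedef (overloaded) 'a cfun = "{f :: 'a::topological_space \<Rightarrow> real. continuous_on UNIV f}"
  morphisms apply_cfun Abs_cfun
  by (rule exI[of _ "\<lambda>_. 0"]) simp

setup_lifting type_definition_cfun

text \<open>The topology of uniform convergence on compact sets; \<^term>\<open>borel\<close> on this type is
  its Borel sigma-algebra.\<close>

instantiation cfun :: (topological_space) topological_space
begin

definition open_cfun :: "'a cfun set \<Rightarrow> bool" where
  "open_cfun U \<longleftrightarrow> (\<forall>f\<in>U. \<exists>C e. compact C \<and> 0 < e \<and>
     (\<forall>g. (\<forall>x\<in>C. \<bar>apply_cfun g x - apply_cfun f x\<bar> < e) \<longrightarrow> g \<in> U))"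

instance
proof
  show "open (UNIV :: 'a cfun set)"
    unfolding open_cfun_def
  proof
    fix f :: "'a cfun"
    show "\<exists>C e. compact C \<and> 0 < (e::real) \<and>
      (\<forall>g. (\<forall>x\<in>C. \<bar>apply_cfun g x - apply_cfun f x\<bar> < e) \<longrightarrow> g \<in> UNIV)"
      by (rule exI[of _ "{}"], rule exI[of _ 1]) simp
  qed
next
  fix S T :: "'a cfun set"
  assume S: "open S" and T: "open T"
  show "open (S \<inter> T)"
    unfolding open_cfun_def
  proof
    fix f assume f: "f \<in> S \<inter> T"
    obtain C e where C: "compact C" "0 < e"
        "\<forall>g. (\<forall>x\<in>C. \<bar>apply_cfun g x - apply_cfun f x\<bar> < e) \<longrightarrow> g \<in> S"
      using bspec[OF S[unfolded open_cfun_def] IntD1[OF f]] by (elim exE conjE) (rule that)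
    obtain D d where D: "compact D" "0 < d"
        "\<forall>g. (\<forall>x\<in>D. \<bar>apply_cfun g x - apply_cfun f x\<bar> < d) \<longrightarrow> g \<in> T"
      using bspec[OF T[unfolded open_cfun_def] IntD2[OF f]] by (elim exE conjE) (rule that)
    show "\<exists>C e. compact C \<and> 0 < e \<and>
      (\<forall>g. (\<forall>x\<in>C. \<bar>apply_cfun g x - apply_cfun f x\<bar> < e) \<longrightarrow> g \<in> S \<inter> T)"
      by (rule exI[of _ "C \<union> D"], rule exI[of _ "min e d"]) (use C D in auto)
  qed
next
  fix K :: "'a cfun set set"
  assume K: "\<forall>S\<in>K. open S"
  show "open (\<Union>K)"
    unfolding open_cfun_def
  proof
    fix f assume "f \<in> \<Union>K"
    then obtain S where S: "S \<in> K" "f \<in> S" by blast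
    have "open S" using K S(1) by blast
    obtain C e where C: "compact C" "0 < e"
        "\<forall>g. (\<forall>x\<in>C. \<bar>apply_cfun g x - apply_cfun f x\<bar> < e) \<longrightarrow> g \<in> S"
      using bspec[OF \<open>open S\<close>[unfolded open_cfun_def] S(2)] by (elim exE conjE) (rule that)
    show "\<exists>C e. compact C \<and> 0 < e \<and>
      (\<forall>g. (\<forall>x\<in>C. \<bar>apply_cfun g x - apply_cfun f x\<bar> < e) \<longrightarrow> g \<in> \<Union>K)"
      by (rule exI[of _ C], rule exI[of _ e]) (use C S(1) in auto)
  qed
qed

end

lift_definition rescale :: "real \<Rightarrow> real \<Rightarrow> 'a::real_normed_vector cfun \<Rightarrow> 'a cfun"
  is "\<lambda>\<alpha> l f x. l powr (- \<alpha>) * f (l *\<^sub>R x)"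
proof -
  fix \<alpha> l :: real and f :: "'a \<Rightarrow> real"
  assume "continuous_on UNIV f"
  then have "continuous_on UNIV (\<lambda>x. f (l *\<^sub>R x))"
    by (rule continuous_on_compose2) (auto intro!: continuous_intros)
  then show "continuous_on UNIV (\<lambda>x. l powr (- \<alpha>) * f (l *\<^sub>R x))"
    by (intro continuous_intros)
qed

definition converges_in_law ::
  "'w measure \<Rightarrow> ('i \<Rightarrow> 'w \<Rightarrow> 'b::topological_space) \<Rightarrow> ('w \<Rightarrow> 'b) \<Rightarrow> 'i filter \<Rightarrow> bool" where
  "converges_in_law M X Y F \<longleftrightarrow>
     (\<forall>\<phi> :: 'b \<Rightarrow> real. continuous_on UNIV \<phi> \<and> bounded (range \<phi>) \<longrightarrow>
        ((\<lambda>i. \<integral>\<omega>. \<phi> (X i \<omega>) \<partial>M) \<longlongrightarrow> (\<integral>\<omega>. \<phi> (Y \<omega>) \<partial>M)) F)"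


section \<open>Random walks with a given transition kernel\<close>

text \<open>The transition probability p(x,y) is \<^term>\<open>pmf (K x) y\<close>. The walk is realised as the
  coordinate process on path space, with the law provided by the Ionescu-Tulcea theorem;
  the lemma on cylinder probabilities below characterises this law.\<close>

definition walk_kernel :: "('a \<Rightarrow> 'a pmf) \<Rightarrow> 'a \<Rightarrow> nat \<Rightarrow> (nat \<Rightarrow> 'a) \<Rightarrow> 'a measure" where
  "walk_kernel K x n X = measure_pmf (if n = 0 then return_pmf x else K (X (n - 1)))"

definition walk_law :: "('a \<Rightarrow> 'a pmf) \<Rightarrow> 'a \<Rightarrow> (nat \<Rightarrow> 'a) measure" where
  "walk_law K x =
     projective_family.lim UNIV
       (Ionescu_Tulcea.CI (walk_kernel K x) (\<lambda>_. count_space UNIV)) (\<lambda>_. count_space UNIV)"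

lemma Ionescu_Tulcea_walk: "Ionescu_Tulcea (walk_kernel K x) (\<lambda>_. count_space UNIV)"
proof (rule Ionescu_Tulcea.intro)
  fix i :: nat
  show "walk_kernel K x i \<in>
      measurable (PiM {0..<i} (\<lambda>_. count_space UNIV)) (subprob_algebra (count_space UNIV))"
  proof (cases i)
    case 0
    then show ?thesis
      by (auto simp: walk_kernel_def[abs_def] space_subprob_algebra
               intro!: measurable_const measure_pmf.subprob_space_axioms)
  next
    case (Suc j)
    have "(\<lambda>X. X j) \<in> measurable (PiM {0..<i} (\<lambda>_. count_space UNIV)) (count_space UNIV)"
      using Suc by (intro measurable_component_singleton) auto
    moreover have "(\<lambda>y. measure_pmf (K y)) \<in>
        measurable (count_space UNIV) (subprob_algebra (count_space UNIV))"
      by (auto simp: space_subprob_algebra intro!: measure_pmf.subprob_space_axioms)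
    ultimately have "(\<lambda>X. measure_pmf (K (X j))) \<in>
        measurable (PiM {0..<i} (\<lambda>_. count_space UNIV)) (subprob_algebra (count_space UNIV))"
      by (rule measurable_compose)
    then show ?thesis
      using Suc by (simp add: walk_kernel_def[abs_def])
  qed
next
  fix i X
  show "prob_space (walk_kernel K x i X)"
    by (simp add: walk_kernel_def measure_pmf.prob_space_axioms)
qed

lemma sets_walk_law: "sets (walk_law K x) = sets (PiM UNIV (\<lambda>_. count_space UNIV))"
proof -
  interpret Ionescu_Tulcea "walk_kernel K x" "\<lambda>_. count_space UNIV"
    by (rule Ionescu_Tulcea_walk)
  show ?thesis
    by (simp add: walk_law_def)
qed

lemma emeasure_walk_law_cylinder:
  "emeasure (walk_law K x) {X. \<forall>i\<le>n. X i = xs i} =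
     ennreal (indicator {x} (xs 0) * (\<Prod>i<n. pmf (K (xs i)) (xs (Suc i))))"
proof -
  let ?N = "\<lambda>_::nat. count_space (UNIV :: 'a set)"
  interpret Ionescu_Tulcea "walk_kernel K x" ?N
    by (rule Ionescu_Tulcea_walk)
  define A where "A n = PiE {0..<n} (\<lambda>i. {xs i})" for n
  have A[measurable]: "A n \<in> sets (PiM {0..<n} ?N)" for n
    unfolding A_def by (intro sets_PiM_I_finite) auto
  have u: "(\<lambda>_. undefined) \<in> space (PiM {0..<0} ?N)"
    by (simp add: space_PiM)
  have step: "eP m X (A (Suc m)) = emeasure (walk_kernel K x m xs) {xs m} * indicator (A m) X"
    if X: "X \<in> space (PiM {0..<m} ?N)" for m X
  proof -
    have "fun_upd X m -` A (Suc m) = (if X \<in> A m then {xs m} else {})"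
      using X by (auto simp: A_def PiE_iff space_PiM extensional_def less_Suc_eq split: if_splits)
    moreover have "walk_kernel K x m X = walk_kernel K x m xs" if "X \<in> A m"
      using that by (cases m) (auto simp: walk_kernel_def A_def PiE_iff)
    ultimately show ?thesis
      using X by (simp add: emeasure_eP split: split_indicator)
  qed
  have C: "emeasure (C 0 m (\<lambda>_. undefined)) (A m) =
      (\<Prod>i<m. emeasure (walk_kernel K x i xs) {xs i})" for m
  proof (induction m)
    case 0
    have "(\<lambda>_. undefined) \<in> A 0"
      by (simp add: A_def)
    then show ?case
      using A[of 0] by simp
  next
    case (Suc m)
    have "emeasure (C 0 (Suc m) (\<lambda>_. undefined)) (A (Suc m)) =
        (\<integral>\<^sup>+X. eP m X (A (Suc m)) \<partial>C 0 m (\<lambda>_. undefined))"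
      unfolding C.simps add_0
    proof (rule emeasure_bind)
      show "space (C 0 m (\<lambda>_. undefined)) \<noteq> {}"
        using prob_space_C[OF u] by (rule prob_space.not_empty)
      show "eP m \<in> measurable (C 0 m (\<lambda>_. undefined)) (subprob_algebra (PiM {0..<Suc m} ?N))"
        using measurable_eP[of m] sets_C[OF u, of m]
        by (simp only: add_0 measurable_cong_sets[OF sets_C[OF u] refl])
    qed (rule A)
    also have "\<dots> = (\<integral>\<^sup>+X. emeasure (walk_kernel K x m xs) {xs m} * indicator (A m) X
        \<partial>C 0 m (\<lambda>_. undefined))"
      by (rule nn_integral_cong) (use u in \<open>simp add: space_C step\<close>)
    also have "\<dots> = emeasure (walk_kernel K x m xs) {xs m} *
        emeasure (C 0 m (\<lambda>_. undefined)) (A m)"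
      by (rule nn_integral_cmult_indicator) (use u in \<open>simp add: sets_C\<close>)
    finally show ?case
      by (simp add: Suc.IH mult.commute)
  qed
  have "{X. \<forall>i\<le>n. X i = xs i} = PF.emb UNIV {0..<Suc n} (A (Suc n))"
    by (auto simp: prod_emb_def A_def space_PiM PiE_iff)
  then have "emeasure (walk_law K x) {X. \<forall>i\<le>n. X i = xs i} =
      emeasure (CI {0..<Suc n}) (A (Suc n))"
    unfolding walk_law_def by (simp only:) (rule lim, auto)
  also have "\<dots> = emeasure (C 0 (Suc n) (\<lambda>_. undefined))
      (PF.emb {0..<Suc n} {0..<Suc n} (A (Suc n)))"
    by (rule emeasure_CI) auto
  also have "PF.emb {0..<Suc n} {0..<Suc n} (A (Suc n)) = A (Suc n)"
    by (rule prod_emb_id) (auto simp only: A_def PiE_iff space_count_space UNIV_I)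
  also have "emeasure (C 0 (Suc n) (\<lambda>_. undefined)) (A (Suc n)) =
      indicator {x} (xs 0) * (\<Prod>i<n. ennreal (pmf (K (xs i)) (xs (Suc i))))"
    unfolding C prod.lessThan_Suc_shift
    by (simp add: walk_kernel_def emeasure_pmf_single indicator_def)
  finally show ?thesis
    by (simp add: prod_ennreal indicator_def)
qed

definition irreducible_walk :: "('a \<Rightarrow> 'a pmf) \<Rightarrow> bool" where
  "irreducible_walk K \<longleftrightarrow> (\<forall>x y. \<exists>n. 0 < \<P>(X in walk_law K x. X n = y))"

definition recurrent_walk :: "('a \<Rightarrow> 'a pmf) \<Rightarrow> bool" where
  "recurrent_walk K \<longleftrightarrow> (\<forall>x. \<P>(X in walk_law K x. \<exists>n\<ge>1. X n = x) = 1)"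

definition invariant_measure :: "('a \<Rightarrow> 'a pmf) \<Rightarrow> ('a \<Rightarrow> real) \<Rightarrow> bool" where
  "invariant_measure K \<mu> \<longleftrightarrow>
     (\<forall>x. 0 < \<mu> x) \<and> (\<forall>y. ((\<lambda>x. \<mu> x * pmf (K x) y) has_sum \<mu> y) UNIV)"

definition lattice_pt :: "int ^ 'd \<Rightarrow> real ^ 'd" where
  "lattice_pt x = (\<chi> i. real_of_int (x $ i))"

definition nearest_neighbor :: "(int ^ 'd \<Rightarrow> (int ^ 'd) pmf) \<Rightarrow> bool" where
  "nearest_neighbor K \<longleftrightarrow>
     (\<forall>x y. 0 < pmf (K x) y \<longrightarrow> norm (lattice_pt x - lattice_pt y) = 1)"

end

theory Submission
  imports Defs "HOL-Real_Asymp.Real_Asymp"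
begin

text \<open>
  Let \<open>A\<close> be a finite set containing the starting point \<open>x\<close>. The Green function of the walk killed
  on returning to \<open>x\<close> or leaving \<open>A\<close> is at most \<open>\<mu> / \<mu> x\<close>, so by invariance of \<open>\<mu>\<close> the walk avoids
  \<open>x\<close> forever with probability at most \<open>\<mu> B / \<mu> x\<close>, where \<open>B\<close> is the outer boundary of \<open>A\<close>.
  Hence it suffices to surround the origin, at arbitrarily
  large scales \<open>l\<close>, by lattice boundaries on which \<open>V\<close> exceeds \<open>l powr \<alpha> / n\<close>: they carry mass at most
  polynomial in \<open>l\<close> times \<open>exp (- (l powr \<alpha>) / n)\<close>. The limit \<open>W\<close> has such a barrier by hypothesis
  (as \<open>W 0 = 0\<close>), and having a barrier is an open condition, so convergence in law produces barriers
  of \<open>rescale \<alpha> l V\<close> with probability close to 1 for each large \<open>l\<close>, hence almost surely for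
  infinitely many \<open>l\<close>.
\<close>

section \<open>Path space of the walk\<close>

lemma space_walk_law [simp]: "space (walk_law K x) = UNIV"
  using sets_eq_imp_space_eq[OF sets_walk_law[of K x]] by (simp add: space_PiM)

lemma sets_walk_law_cylinder: "{X. \<forall>i\<le>n. X i = xs i} \<in> sets (walk_law K x)"
proof -
  have "{X. \<forall>i\<le>n. X i = xs i} = {X \<in> space (PiM UNIV (\<lambda>_. count_space UNIV)). \<forall>i\<in>{..n}. X i = xs i}"
    by (auto simp: space_PiM)
  also have "\<dots> \<in> sets (PiM UNIV (\<lambda>_. count_space UNIV))"
    by measurable
  finally show ?thesis
    by (simp add: sets_walk_law)
qed

text \<open>Only countably many paths are possible up to time \<open>n\<close>, so an event
  determined by them is a countable disjoint union of cylinders. The index paths are extensional on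
  \<open>{..n}\<close> so that each cylinder occurs exactly once.\<close>

lemma
  fixes K :: "'a::countable \<Rightarrow> 'a pmf"
  assumes loc: "\<And>X Y. (\<And>i. i \<le> n \<Longrightarrow> X i = Y i) \<Longrightarrow> P X \<longleftrightarrow> P Y"
  shows sets_walk_law_local: "{X. P X} \<in> sets (walk_law K x)" (is ?A)
    and emeasure_walk_law_local: "emeasure (walk_law K x) {X. P X} =
      (\<integral>\<^sup>+xs. emeasure (walk_law K x) {X. \<forall>i\<le>n. X i = xs i}
        \<partial>count_space {xs \<in> PiE {..n} (\<lambda>_. UNIV). P xs})" (is ?B)
proof -
  let ?I = "{xs \<in> PiE {..n} (\<lambda>_. UNIV). P xs}"
  have I: "countable ?I"
    by (rule countable_subset[OF _ countable_PiE[of "{..n}" "\<lambda>_. UNIV :: 'a set"]]) auto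
  have eq: "{X. P X} = (\<Union>xs\<in>?I. {X. \<forall>i\<le>n. X i = xs i})"
  proof (intro equalityI subsetI)
    fix X assume "X \<in> {X. P X}"
    moreover have "P X \<longleftrightarrow> P (restrict X {..n})"
      by (rule loc) simp
    ultimately have "restrict X {..n} \<in> ?I" by auto
    moreover have "X \<in> {Y. \<forall>i\<le>n. Y i = restrict X {..n} i}" by simp
    ultimately show "X \<in> (\<Union>xs\<in>?I. {X. \<forall>i\<le>n. X i = xs i})" by blast
  next
    fix X assume "X \<in> (\<Union>xs\<in>?I. {X. \<forall>i\<le>n. X i = xs i})"
    then obtain xs where "P xs" "\<forall>i\<le>n. X i = xs i" by blast
    then show "X \<in> {X. P X}" using loc[of X xs] by auto
  qed
  show ?A
    unfolding eq by (intro sets.countable_UN' I image_subsetI sets_walk_law_cylinder)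
  have disj: "disjoint_family_on (\<lambda>xs. {X. \<forall>i\<le>n. X i = xs i}) ?I"
  proof (unfold disjoint_family_on_def, intro ballI impI)
    fix xs ys assume "xs \<in> ?I" "ys \<in> ?I" "xs \<noteq> ys"
    then obtain i where "i \<le> n" "xs i \<noteq> ys i"
      using PiE_ext[of xs "{..n}" "\<lambda>_. UNIV" ys] by blast
    then show "{X. \<forall>i\<le>n. X i = xs i} \<inter> {X. \<forall>i\<le>n. X i = ys i} = {}" by auto
  qed
  show ?B
    by (subst eq, rule emeasure_UN_countable[OF sets_walk_law_cylinder I disj])
qed

lemma emeasure_walk_law_start:
  fixes K :: "'a::countable \<Rightarrow> 'a pmf"
  shows "emeasure (walk_law K x) {X. X 0 = y} = indicator {x} y"
  using emeasure_walk_law_cylinder[of K x 0 "\<lambda>_. y"] by (simp add: ennreal_indicator)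

lemma prob_space_walk_law:
  fixes K :: "'a::countable \<Rightarrow> 'a pmf"
  shows "prob_space (walk_law K x)"
proof
  let ?W = "walk_law K x"
  have "emeasure ?W UNIV = emeasure ?W (\<Union>y. {X. X 0 = y})"
    by (rule arg_cong[where f = "emeasure _"]) auto
  also have "\<dots> = (\<integral>\<^sup>+y. emeasure ?W {X. X 0 = y} \<partial>count_space UNIV)"
    by (rule emeasure_UN_countable)
      (auto simp: disjoint_family_on_def intro!: sets_walk_law_local[where n = 0])
  also have "\<dots> = 1"
    by (simp add: emeasure_walk_law_start)
  finally show "emeasure ?W (space ?W) = 1" by simp
qed

text \<open>The history event splits into cylinders ending in \<open>z\<close>. Prolonging any of
  these by \<open>y\<close> multiplies its product formula by the same factor
  \<open>pmf (K z) y\<close>, which therefore leaves the sum.\<close>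

lemma walk_law_Markov:
  fixes K :: "'a::countable \<Rightarrow> 'a pmf"
  assumes loc: "\<And>X Y. (\<And>i. i \<le> n \<Longrightarrow> X i = Y i) \<Longrightarrow> P X \<longleftrightarrow> P Y"
  shows "\<P>(X in walk_law K x. P X \<and> X n = z \<and> X (Suc n) = y) =
    \<P>(X in walk_law K x. P X \<and> X n = z) * pmf (K z) y"
proof -
  let ?W = "walk_law K x"
  interpret prob_space ?W by (rule prob_space_walk_law)
  let ?Q = "\<lambda>X. P X \<and> X n = z"
  let ?I = "{xs \<in> PiE {..n} (\<lambda>_. UNIV). ?Q xs}"
  let ?C = "\<lambda>m xs. {X. \<forall>i\<le>m. X i = xs i}"
  have I: "countable ?I"
    by (rule countable_subset[OF _ countable_PiE[of "{..n}" "\<lambda>_. UNIV :: 'a set"]]) auto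
  have loc': "?Q X \<longleftrightarrow> ?Q Y" if "\<And>i. i \<le> n \<Longrightarrow> X i = Y i" for X Y
    using loc[of X Y] that[of n] that by auto
  have eq: "{X. ?Q X \<and> X (Suc n) = y} = (\<Union>xs\<in>?I. ?C (Suc n) (xs(Suc n := y)))"
  proof (intro equalityI subsetI)
    fix X assume X: "X \<in> {X. ?Q X \<and> X (Suc n) = y}"
    moreover have "?Q X \<longleftrightarrow> ?Q (restrict X {..n})"
      by (rule loc') simp
    ultimately have "restrict X {..n} \<in> ?I" by auto
    moreover have "X \<in> ?C (Suc n) ((restrict X {..n})(Suc n := y))"
      using X by auto
    ultimately show "X \<in> (\<Union>xs\<in>?I. ?C (Suc n) (xs(Suc n := y)))" by blast
  next
    fix X assume "X \<in> (\<Union>xs\<in>?I. ?C (Suc n) (xs(Suc n := y)))"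
    then obtain xs where xs: "?Q xs" "\<And>i. i \<le> Suc n \<Longrightarrow> X i = (xs(Suc n := y)) i" by blast
    have "?Q X \<longleftrightarrow> ?Q xs" by (rule loc') (use xs(2) in auto)
    then show "X \<in> {X. ?Q X \<and> X (Suc n) = y}" using xs xs(2)[of "Suc n"] by auto
  qed
  have disj: "disjoint_family_on (\<lambda>xs. ?C (Suc n) (xs(Suc n := y))) ?I"
  proof (unfold disjoint_family_on_def, intro ballI impI)
    fix xs ys assume "xs \<in> ?I" "ys \<in> ?I" "xs \<noteq> ys"
    then obtain i where "i \<le> n" "xs i \<noteq> ys i"
      using PiE_ext[of xs "{..n}" "\<lambda>_. UNIV" ys] by blast
    show "?C (Suc n) (xs(Suc n := y)) \<inter> ?C (Suc n) (ys(Suc n := y)) = {}"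
    proof (rule equals0I)
      fix X
      assume X: "X \<in> ?C (Suc n) (xs(Suc n := y)) \<inter> ?C (Suc n) (ys(Suc n := y))"
      have "i \<noteq> Suc n" "i \<le> Suc n" using \<open>i \<le> n\<close> by auto
      moreover from X this(2) have "X i = (xs(Suc n := y)) i" "X i = (ys(Suc n := y)) i"
        by blast+
      ultimately show False using \<open>xs i \<noteq> ys i\<close> by simp
    qed
  qed
  have "emeasure ?W {X. ?Q X \<and> X (Suc n) = y} =
      (\<integral>\<^sup>+xs. emeasure ?W (?C (Suc n) (xs(Suc n := y))) \<partial>count_space ?I)"
    by (subst eq, rule emeasure_UN_countable[OF sets_walk_law_cylinder I disj])
  also have "\<dots> = (\<integral>\<^sup>+xs. emeasure ?W (?C n xs) * ennreal (pmf (K z) y) \<partial>count_space ?I)"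
  proof (rule nn_integral_cong)
    fix xs assume "xs \<in> space (count_space ?I)"
    then have "xs n = z" by simp
    have "emeasure ?W (?C (Suc n) (xs(Suc n := y))) = ennreal (indicator {x} (xs 0) *
      (\<Prod>i<Suc n. pmf (K ((xs(Suc n := y)) i)) ((xs(Suc n := y)) (Suc i))))"
      using emeasure_walk_law_cylinder[of K x "Suc n" "xs(Suc n := y)"] by simp
    also have "(\<Prod>i<Suc n. pmf (K ((xs(Suc n := y)) i)) ((xs(Suc n := y)) (Suc i))) =
      (\<Prod>i<n. pmf (K (xs i)) (xs (Suc i))) * pmf (K z) y"
      using \<open>xs n = z\<close> by simp
    also have "ennreal (indicator {x} (xs 0) * \<dots>) =
      emeasure ?W (?C n xs) * ennreal (pmf (K z) y)"
      unfolding emeasure_walk_law_cylinder mult.assoc[symmetric] by (rule ennreal_mult'') simp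
    finally show "emeasure ?W (?C (Suc n) (xs(Suc n := y))) =
      emeasure ?W (?C n xs) * ennreal (pmf (K z) y)" .
  qed
  also have "\<dots> = emeasure ?W {X. ?Q X} * ennreal (pmf (K z) y)"
    using emeasure_walk_law_local[of n ?Q K x, OF loc'] by (simp add: nn_integral_multc)
  finally have "ennreal (prob {X. ?Q X \<and> X (Suc n) = y}) = ennreal (prob {X. ?Q X} * pmf (K z) y)"
    by (simp add: emeasure_eq_measure ennreal_mult'')
  then show ?thesis by simp
qed

text \<open>Each transition of probability zero is a null event by the Markov property, and there
  are only countably many pairs of states.\<close>

lemma AE_walk_law_step:
  fixes K :: "'a::countable \<Rightarrow> 'a pmf"
  shows "AE X in walk_law K x. X (Suc n) \<in> set_pmf (K (X n))"
proof -
  interpret prob_space "walk_law K x" by (rule prob_space_walk_law)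
  have "AE X in walk_law K x. \<not> (X n = z \<and> X (Suc n) = y)" if "pmf (K z) y = 0" for z y
  proof (rule AE_I')
    have "{X. X n = z \<and> X (Suc n) = y} \<in> events"
      by (rule sets_walk_law_local[where n = "Suc n"]) auto
    then show "{X. X n = z \<and> X (Suc n) = y} \<in> null_sets (walk_law K x)"
      using walk_law_Markov[of n "\<lambda>_. True" K x z y] that by (auto simp: emeasure_eq_measure)
  qed auto
  then have "AE X in walk_law K x. \<forall>z y. pmf (K z) y = 0 \<longrightarrow> \<not> (X n = z \<and> X (Suc n) = y)"
    unfolding AE_all_countable by auto
  then show ?thesis
    by eventually_elim (auto simp: set_pmf_iff)
qed

lemma AE_walk_law_start:
  fixes K :: "'a::countable \<Rightarrow> 'a pmf"
  shows "AE X in walk_law K x. X 0 = x"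
proof -
  interpret prob_space "walk_law K x" by (rule prob_space_walk_law)
  have "{X. X 0 = x} \<in> events"
    by (rule sets_walk_law_local[where n = 0]) auto
  moreover have "prob {X. X 0 = x} = 1"
    using emeasure_walk_law_start[of K x x] by (simp add: emeasure_eq_measure)
  ultimately show ?thesis
    using AE_prob_1[of "{X. X 0 = x}"] by simp
qed

section \<open>A recurrence criterion\<close>

lemma invariant_measure_sum_le:
  assumes "invariant_measure K \<mu>" "finite A"
  shows "(\<Sum>w\<in>A. \<mu> w * pmf (K w) y) \<le> \<mu> y"
proof (rule finite_sum_le_has_sum)
  show "((\<lambda>w. \<mu> w * pmf (K w) y) has_sum \<mu> y) UNIV"
    using assms(1) by (simp add: invariant_measure_def)
  show "0 \<le> \<mu> w * pmf (K w) y" for w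
    using assms(1) by (simp add: invariant_measure_def less_imp_le)
qed (use assms(2) in auto)

text \<open>For every \<open>n\<close>, a path avoiding \<open>x\<close> either survives in
  \<open>A - {x}\<close> up to time \<open>n\<close> or has stepped into \<open>B\<close> before.
  Exits into \<open>y\<close> have total mass at most \<open>\<mu> y / \<mu> x\<close>, while
  survival has probability tending to 0 because the killed Green function is finite on the finite
  set \<open>A\<close>.\<close>

lemma walk_law_no_return_le:
  fixes K :: "'a::countable \<Rightarrow> 'a pmf"
  assumes inv: "invariant_measure K \<mu>"
    and A: "finite A" "x \<in> A" and B: "finite B"
    and exits: "\<And>z. z \<in> A \<Longrightarrow> set_pmf (K z) \<subseteq> A \<union> B"
  shows "\<P>(X in walk_law K x. \<forall>n\<ge>1. X n \<noteq> x) \<le> (\<Sum>y\<in>B. \<mu> y) / \<mu> x"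
proof -
  let ?W = "walk_law K x"
  interpret prob_space ?W by (rule prob_space_walk_law)
  have pos: "0 < \<mu> y" for y
    using inv by (simp add: invariant_measure_def)
  \<comment> \<open>The walk is killed on returning to \<open>x\<close> or leaving \<open>A\<close>;
    \<open>u n\<close> is the sub-probability law of the killed walk at time \<open>n\<close>, and
    its sum over \<open>n\<close> is the killed Green function.\<close>
  define E where "E n X \<longleftrightarrow> X 0 = x \<and> (\<forall>i\<in>{1..n}. X i \<in> A - {x})" for n and X :: "nat \<Rightarrow> 'a"
  define u where "u n z = prob {X. E n X \<and> X n = z}" for n z
  have locE: "E n X \<longleftrightarrow> E n Y" if "\<And>i. i \<le> n \<Longrightarrow> X i = Y i" for n X Y
    using that by (simp add: E_def)
  have E_A: "X n \<in> A" if "E n X" for n X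
  proof (cases "n = 0")
    case False
    then have "n \<in> {1..n}" by simp
    then show ?thesis using that unfolding E_def by blast
  qed (use that A(2) in \<open>simp add: E_def\<close>)
  have E_Suc: "E (Suc n) X \<longleftrightarrow> E n X \<and> X (Suc n) \<in> A - {x}" for n X
    by (auto simp: E_def atLeastAtMostSuc_conv)
  have meas_E [measurable]: "{X. E n X} \<in> events" for n
    by (rule sets_walk_law_local[where n = n]) (simp add: E_def)
  have meas_u [measurable]: "{X. E n X \<and> X n = z} \<in> events" for n z
    by (rule sets_walk_law_local[where n = n]) (simp add: E_def)
  have meas_e [measurable]: "{X. E n X \<and> X (Suc n) = y} \<in> events" for n y
    by (rule sets_walk_law_local[where n = "Suc n"]) (simp add: E_def)
  have prob_E: "prob {X. E n X} = (\<Sum>z\<in>A. u n z)" for n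
  proof -
    have "{X. E n X} = (\<Union>z\<in>A. {X. E n X \<and> X n = z})"
      using E_A by auto
    then show ?thesis
      unfolding u_def
      by (simp only:) (rule finite_measure_finite_Union, use A(1) in \<open>auto simp: disjoint_family_on_def\<close>)
  qed
  have prob_step: "prob {X. E n X \<and> X (Suc n) = y} = (\<Sum>z\<in>A. u n z * pmf (K z) y)" for n y
  proof -
    have "{X. E n X \<and> X (Suc n) = y} = (\<Union>z\<in>A. {X. E n X \<and> X n = z \<and> X (Suc n) = y})"
      using E_A by auto
    moreover have "{X. E n X \<and> X n = z \<and> X (Suc n) = y} \<in> events" for z
      by (rule sets_walk_law_local[where n = "Suc n"]) (simp add: E_def)
    ultimately have "prob {X. E n X \<and> X (Suc n) = y} =
        (\<Sum>z\<in>A. prob {X. E n X \<and> X n = z \<and> X (Suc n) = y})"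
      by (simp only:) (rule finite_measure_finite_Union, use A(1) in \<open>auto simp: disjoint_family_on_def\<close>)
    also have "\<dots> = (\<Sum>z\<in>A. u n z * pmf (K z) y)"
      using walk_law_Markov[of n "E n" K x, OF locE] by (simp add: u_def)
    finally show ?thesis .
  qed
  have u_Suc: "u (Suc n) y = (if y \<in> A - {x} then \<Sum>z\<in>A. u n z * pmf (K z) y else 0)" for n y
  proof -
    have "{X. E (Suc n) X \<and> X (Suc n) = y} = (if y \<in> A - {x} then {X. E n X \<and> X (Suc n) = y} else {})"
      by (auto simp: E_Suc)
    then show ?thesis
      unfolding u_def[of "Suc n" y] by (simp only: prob_step split: if_split) auto
  qed
  have u_0: "u 0 y = 0" if "y \<noteq> x" for y
  proof -
    have "{X. E 0 X \<and> X 0 = y} = {}" using that by (auto simp: E_def)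
    then show ?thesis unfolding u_def by (simp only: measure_empty)
  qed
  \<comment> \<open>Induction on the time horizon. At a site of \<open>A - {x}\<close> the time-0
    term vanishes, and one-step decomposition reduces the rest to the shorter horizon, where
    invariance of \<open>\<mu>\<close> closes the estimate. At \<open>x\<close> only time 0 counts,
    with mass at most 1; elsewhere the Green function is 0.\<close>
  have green: "\<mu> x * (\<Sum>k<N. u k z) \<le> \<mu> z" for N z
  proof (induction N arbitrary: z)
    case 0
    then show ?case using pos[of z] by simp
  next
    case (Suc N)
    show ?case
    proof (cases "z \<in> A - {x}")
      case True
      have "\<mu> x * (\<Sum>k<Suc N. u k z) = \<mu> x * (\<Sum>k<N. \<Sum>w\<in>A. u k w * pmf (K w) z)"
        using True u_0 by (simp add: sum.lessThan_Suc_shift u_Suc del: sum.lessThan_Suc)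
      also have "\<dots> = (\<Sum>w\<in>A. (\<mu> x * (\<Sum>k<N. u k w)) * pmf (K w) z)"
        by (subst sum.swap) (simp add: sum_distrib_left sum_distrib_right mult.assoc)
      also have "\<dots> \<le> (\<Sum>w\<in>A. \<mu> w * pmf (K w) z)"
        by (intro sum_mono mult_right_mono Suc.IH) simp
      also have "\<dots> \<le> \<mu> z"
        by (rule invariant_measure_sum_le[OF inv A(1)])
      finally show ?thesis .
    next
      case False
      then have "u (Suc k) z = 0" for k
        unfolding u_Suc by (rule if_not_P)
      then have "(\<Sum>k<Suc N. u k z) = u 0 z"
        by (simp add: sum.lessThan_Suc_shift del: sum.lessThan_Suc)
      moreover have "\<mu> x * u 0 z \<le> \<mu> z"
      proof (cases "z = x")
        case True
        then show ?thesis using pos[of x] by (simp add: u_def)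
      qed (use u_0 pos[of z] in simp)
      ultimately show ?thesis by simp
    qed
  qed
  \<comment> \<open>The one-step computation once more, now with an arbitrary target
    \<open>y\<close>, where the last step need not stay in \<open>A - {x}\<close>.\<close>
  have exit: "(\<Sum>j<n. prob {X. E j X \<and> X (Suc j) = y}) \<le> \<mu> y / \<mu> x" for n y
  proof -
    have "\<mu> x * (\<Sum>j<n. prob {X. E j X \<and> X (Suc j) = y}) =
        (\<Sum>w\<in>A. (\<mu> x * (\<Sum>k<n. u k w)) * pmf (K w) y)"
      unfolding prob_step
      by (subst sum.swap) (simp add: sum_distrib_left sum_distrib_right mult.assoc)
    also have "\<dots> \<le> (\<Sum>w\<in>A. \<mu> w * pmf (K w) y)"
      by (intro sum_mono mult_right_mono green) simp
    also have "\<dots> \<le> \<mu> y"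
      by (rule invariant_measure_sum_le[OF inv A(1)])
    finally show ?thesis
      using pos[of x] by (simp add: pos_le_divide_eq mult.commute)
  qed
  have bound: "prob {X. \<forall>n\<ge>1. X n \<noteq> x} \<le> (\<Sum>z\<in>A. u n z) + (\<Sum>y\<in>B. \<mu> y) / \<mu> x" for n
  proof -
    let ?D = "\<Union>j<n. \<Union>y\<in>B. {X. E j X \<and> X (Suc j) = y}"
    have D: "?D \<in> events"
      using B by (intro sets.finite_UN) auto
    have "AE X in ?W. \<forall>j. X (Suc j) \<in> set_pmf (K (X j))"
      by (simp add: AE_all_countable AE_walk_law_step)
    then have "AE X in ?W. X \<in> {X. \<forall>n\<ge>1. X n \<noteq> x} \<longrightarrow> X \<in> {X. E n X} \<union> ?D"
      using AE_walk_law_start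
    proof eventually_elim
      case (elim X)
      show ?case
      proof (intro impI)
        assume "X \<in> {X. \<forall>n\<ge>1. X n \<noteq> x}"
        then have nr: "X (Suc j) \<noteq> x" for j by simp
        \<comment> \<open>The first failure of \<open>E\<close> can only be a step into
          \<open>B\<close>: the step starts in \<open>A\<close>, hence lands in
          \<open>A \<union> B\<close>, and it does not hit \<open>x\<close>.\<close>
        have "E m X \<or> X \<in> (\<Union>j<m. \<Union>y\<in>B. {X. E j X \<and> X (Suc j) = y})" for m
        proof (induction m)
          case 0
          then show ?case using elim(2) by (simp add: E_def)
        next
          case (Suc m)
          show ?case
          proof (cases "E m X")
            case True
            then have "X (Suc m) \<in> A \<union> B"
              using exits[OF E_A[OF True]] elim(1) by blast
            then show ?thesis
              using True nr[of m] by (auto simp: E_Suc)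
          qed (use Suc in \<open>auto simp: less_Suc_eq\<close>)
        qed
        then show "X \<in> {X. E n X} \<union> ?D" by blast
      qed
    qed
    then have "prob {X. \<forall>n\<ge>1. X n \<noteq> x} \<le> prob ({X. E n X} \<union> ?D)"
      using D by (intro finite_measure_mono_AE) auto
    also have "\<dots> \<le> prob {X. E n X} + prob ?D"
      using D by (intro measure_Un_le) auto
    also have "prob ?D \<le> (\<Sum>j<n. prob (\<Union>y\<in>B. {X. E j X \<and> X (Suc j) = y}))"
      using B by (intro finite_measure_subadditive_finite) (auto intro!: sets.finite_UN)
    also have "\<dots> \<le> (\<Sum>j<n. \<Sum>y\<in>B. prob {X. E j X \<and> X (Suc j) = y})"
      using B by (intro sum_mono finite_measure_subadditive_finite) auto
    also have "\<dots> = (\<Sum>y\<in>B. \<Sum>j<n. prob {X. E j X \<and> X (Suc j) = y})"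
      by (rule sum.swap)
    also have "\<dots> \<le> (\<Sum>y\<in>B. \<mu> y / \<mu> x)"
      by (intro sum_mono exit)
    finally show ?thesis
      by (simp add: prob_E sum_divide_distrib)
  qed
  \<comment> \<open>The Green bound makes \<open>u n z\<close> summable in \<open>n\<close>; since
    \<open>A\<close> is finite, the whole survival probability tends to 0.\<close>
  have "(\<lambda>n. u n z) \<longlonglongrightarrow> 0" for z
  proof (rule summable_LIMSEQ_zero, rule summableI_nonneg_bounded)
    show "0 \<le> u n z" for n by (simp add: u_def)
    show "(\<Sum>k<n. u k z) \<le> \<mu> z / \<mu> x" for n
      using green[of z n] pos[of x] by (simp add: pos_le_divide_eq mult.commute)
  qed
  then have "(\<lambda>n. (\<Sum>z\<in>A. u n z) + (\<Sum>y\<in>B. \<mu> y) / \<mu> x) \<longlonglongrightarrow> (\<Sum>z\<in>A. 0) + (\<Sum>y\<in>B. \<mu> y) / \<mu> x"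
    by (intro tendsto_intros)
  then have "(\<lambda>n. (\<Sum>z\<in>A. u n z) + (\<Sum>y\<in>B. \<mu> y) / \<mu> x) \<longlonglongrightarrow> (\<Sum>y\<in>B. \<mu> y) / \<mu> x"
    by simp
  then show ?thesis
    using bound by (intro LIMSEQ_le_const) auto
qed

lemma recurrent_walkI:
  fixes K :: "'a::countable \<Rightarrow> 'a pmf"
  assumes inv: "invariant_measure K \<mu>"
    and sets: "\<And>x e. e > 0 \<Longrightarrow> \<exists>A B. finite A \<and> finite B \<and> x \<in> A \<and>
      (\<forall>z\<in>A. set_pmf (K z) \<subseteq> A \<union> B) \<and> (\<Sum>y\<in>B. \<mu> y) \<le> e"
  shows "recurrent_walk K"
  unfolding recurrent_walk_def
proof
  fix x
  let ?W = "walk_law K x"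
  interpret prob_space ?W by (rule prob_space_walk_law)
  have pos: "0 < \<mu> x"
    using inv by (simp add: invariant_measure_def)
  have "prob {X. \<forall>n\<ge>1. X n \<noteq> x} \<le> 0 + e" if "0 < e" for e
  proof -
    \<comment> \<open>The tolerance \<open>e * \<mu> x\<close> absorbs the later division by
      \<open>\<mu> x\<close>.\<close>
    obtain A B where AB: "finite A" "finite B" "x \<in> A" "\<And>z. z \<in> A \<Longrightarrow> set_pmf (K z) \<subseteq> A \<union> B"
        and le: "(\<Sum>y\<in>B. \<mu> y) \<le> e * \<mu> x"
      using sets[of "e * \<mu> x" x] \<open>0 < e\<close> pos by auto
    have "(\<Sum>y\<in>B. \<mu> y) / \<mu> x \<le> e"
      using le pos by (simp add: pos_divide_le_eq)
    then show ?thesis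
      using walk_law_no_return_le[OF inv AB(1,3,2,4)] by simp
  qed
  then have "prob {X. \<forall>n\<ge>1. X n \<noteq> x} \<le> 0"
    by (rule field_le_epsilon)
  then have "prob {X. \<forall>n\<ge>1. X n \<noteq> x} = 0"
    by (rule antisym) (rule measure_nonneg)
  moreover have "{X. \<exists>n\<ge>1. X n = x} \<in> events"
  proof -
    have "{X. \<exists>n\<ge>1. X n = x} = (\<Union>n\<in>{1..}. {X. X n = x})" by auto
    also have "\<dots> \<in> events"
    proof (intro sets.countable_UN' image_subsetI)
      show "{X. X n = x} \<in> events" for n
        by (rule sets_walk_law_local[where n = n]) simp
    qed simp
    finally show ?thesis .
  qed
  moreover have "space ?W - {X. \<exists>n\<ge>1. X n = x} = {X. \<forall>n\<ge>1. X n \<noteq> x}" by auto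
  ultimately show "prob {X \<in> space ?W. \<exists>n\<ge>1. X n = x} = 1"
    using prob_compl[of "{X. \<exists>n\<ge>1. X n = x}"] by simp
qed

section \<open>Barriers of continuous functions\<close>

text \<open>The closeness condition is symmetric in \<open>f\<close> and \<open>g\<close>, so the
  one-sided estimate gives a two-sided one; this is locally uniform continuity of
  \<open>\<phi>\<close>.\<close>

lemma continuous_on_cfunI:
  fixes \<phi> :: "'a::topological_space cfun \<Rightarrow> real"
  assumes "compact C"
    and le: "\<And>f g e. 0 < e \<Longrightarrow> (\<And>x. x \<in> C \<Longrightarrow> \<bar>apply_cfun g x - apply_cfun f x\<bar> < e) \<Longrightarrow>
      \<phi> f \<le> \<phi> g + e"
  shows "continuous_on UNIV \<phi>"
proof -
  have "open (\<phi> -` B)" if "open B" for B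
    unfolding open_cfun_def
  proof
    fix f assume "f \<in> \<phi> -` B"
    then obtain r where r: "0 < r" "ball (\<phi> f) r \<subseteq> B"
      using \<open>open B\<close> openE by (metis vimageD)
    have "g \<in> \<phi> -` B" if g: "\<forall>x\<in>C. \<bar>apply_cfun g x - apply_cfun f x\<bar> < r / 2" for g
    proof -
      have "\<phi> f \<le> \<phi> g + r / 2" "\<phi> g \<le> \<phi> f + r / 2"
        using g r(1) by (auto intro!: le simp: abs_minus_commute)
      then have "\<phi> g \<in> ball (\<phi> f) r"
        using r(1) by (simp add: dist_real_def)
      then show ?thesis using r(2) by auto
    qed
    then show "\<exists>C e. compact C \<and> 0 < e \<and>
        (\<forall>g. (\<forall>x\<in>C. \<bar>apply_cfun g x - apply_cfun f x\<bar> < e) \<longrightarrow> g \<in> \<phi> -` B)"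
      using \<open>compact C\<close> r(1) by (intro exI[of _ C] exI[of _ "r / 2"]) auto
  qed
  then show ?thesis
    by (simp add: continuous_on_open_vimage)
qed

lemma continuous_on_apply_cfun: "continuous_on A (apply_cfun f)"
  using apply_cfun[of f] continuous_on_subset by auto

lemma continuous_on_rescale:
  "continuous_on UNIV (rescale \<alpha> l :: 'a::real_normed_vector cfun \<Rightarrow> 'a cfun)"
proof -
  have "open (rescale \<alpha> l -` S)" if "open S" for S :: "'a cfun set"
    unfolding open_cfun_def
  proof
    fix f assume "f \<in> rescale \<alpha> l -` S"
    then obtain C e where C: "compact C" "0 < e"
      and S: "\<And>g. (\<forall>x\<in>C. \<bar>apply_cfun g x - apply_cfun (rescale \<alpha> l f) x\<bar> < e) \<Longrightarrow> g \<in> S"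
      using \<open>open S\<close> unfolding open_cfun_def by (meson vimageD)
    \<comment> \<open>Closeness of the rescaled functions on \<open>C\<close> is closeness of the
      originals on the dilated set, up to the factor \<open>c\<close>. Dividing by
      \<open>c + 1\<close> also covers \<open>c = 0\<close>, which occurs for
      \<open>l = 0\<close>.\<close>
    define c where "c = l powr (- \<alpha>)"
    have c: "0 \<le> c" by (simp add: c_def)
    have "g \<in> rescale \<alpha> l -` S"
      if g: "\<forall>x\<in>(\<lambda>x. l *\<^sub>R x) ` C. \<bar>apply_cfun g x - apply_cfun f x\<bar> < e / (c + 1)" for g
    proof -
      have "\<bar>apply_cfun (rescale \<alpha> l g) x - apply_cfun (rescale \<alpha> l f) x\<bar> < e" if "x \<in> C" for x
      proof -
        let ?D = "\<bar>apply_cfun g (l *\<^sub>R x) - apply_cfun f (l *\<^sub>R x)\<bar>"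
        have "?D < e / (c + 1)" using g that by blast
        then have "(c + 1) * ?D < e"
          using c by (simp add: pos_less_divide_eq mult.commute)
        moreover have "c * ?D \<le> (c + 1) * ?D" by (simp add: distrib_right)
        moreover have "\<bar>apply_cfun (rescale \<alpha> l g) x - apply_cfun (rescale \<alpha> l f) x\<bar> = c * ?D"
          using c by (simp add: rescale.rep_eq c_def abs_mult flip: right_diff_distrib)
        ultimately show ?thesis by linarith
      qed
      then show ?thesis using S by simp
    qed
    moreover have "compact ((\<lambda>x. l *\<^sub>R x) ` C)"
      using C(1) by (rule compact_scaling)
    ultimately show "\<exists>C e. compact C \<and> 0 < e \<and>
        (\<forall>g. (\<forall>x\<in>C. \<bar>apply_cfun g x - apply_cfun f x\<bar> < e) \<longrightarrow> g \<in> rescale \<alpha> l -` S)"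
      using C(2) c by (intro exI[of _ "(\<lambda>x. l *\<^sub>R x) ` C"] exI[of _ "e / (c + 1)"]) auto
  qed
  then show ?thesis
    by (simp add: continuous_on_open_vimage)
qed

text \<open>The bound is required near the frontier, not only on it, so that it also holds at the
  lattice points next to a crossing of the frontier.\<close>

definition barrier :: "nat \<Rightarrow> real \<Rightarrow> 'a::euclidean_space cfun \<Rightarrow> bool" where
  "barrier n t f \<longleftrightarrow> (\<exists>U. ball 0 (1 / real n) \<subseteq> U \<and> U \<subseteq> ball 0 (real n) \<and>
     (\<forall>z\<in>frontier U. \<forall>x\<in>cball z (1 / real n). t \<le> apply_cfun f x))"

text \<open>Taking the best level turns a yes/no property into a continuous functional. The cap at 1
  and the extra level 0 keep the set of levels bounded and nonempty.\<close>

definition barrier_height :: "nat \<Rightarrow> 'a::euclidean_space cfun \<Rightarrow> real" where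
  "barrier_height n f = Sup {t \<in> {0..1}. t = 0 \<or> barrier n t f}"

lemma bdd_above_barrier: "bdd_above {t \<in> {0..1::real}. t = 0 \<or> barrier n t f}"
  by (rule bdd_aboveI[of _ 1]) auto

lemma barrier_levels_nonempty: "{t \<in> {0..1::real}. t = 0 \<or> barrier n t f} \<noteq> {}"
  by (auto intro: exI[of _ 0])

lemma barrier_height_ge:
  assumes "0 \<le> t" "t \<le> 1" "t = 0 \<or> barrier n t f"
  shows "t \<le> barrier_height n f"
  unfolding barrier_height_def by (rule cSup_upper[OF _ bdd_above_barrier]) (use assms in auto)

lemma barrier_antimono: "barrier n t f \<Longrightarrow> s \<le> t \<Longrightarrow> barrier n s f"
  unfolding barrier_def by (meson order_trans)

lemma barrier_of_height:
  assumes "0 \<le> s" "s < barrier_height n f"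
  shows "barrier n s f"
proof -
  obtain t where "t \<in> {t \<in> {0..1}. t = 0 \<or> barrier n t f}" "s < t"
    using assms(2) less_cSup_iff[OF barrier_levels_nonempty bdd_above_barrier, of s n f]
    unfolding barrier_height_def by blast
  then show ?thesis
    using assms(1) by (auto intro: barrier_antimono)
qed

text \<open>If \<open>g\<close> is within \<open>e\<close> of \<open>f\<close> on a large ball, the
  same \<open>U\<close> that is a barrier for \<open>f\<close> at level \<open>t\<close> is one for
  \<open>g\<close> at level \<open>t - e\<close>.\<close>

lemma continuous_on_barrier_height:
  "continuous_on UNIV (barrier_height n :: 'a::euclidean_space cfun \<Rightarrow> real)"
proof (rule continuous_on_cfunI)
  show "compact (cball (0::'a) (real n + 1))" by simp
  fix f g :: "'a cfun" and e :: real
  assume e: "0 < e"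
    and fg: "\<And>x. x \<in> cball 0 (real n + 1) \<Longrightarrow> \<bar>apply_cfun g x - apply_cfun f x\<bar> < e"
  have "t - e \<le> barrier_height n g" if t: "t \<in> {t \<in> {0..1}. t = 0 \<or> barrier n t f}" for t
  proof (cases "t - e \<le> 0")
    case True
    then show ?thesis
      using barrier_height_ge[of 0 n g] by simp
  next
    case False
    then have "barrier n t f" using t e by auto
    then obtain U where U: "ball 0 (1 / real n) \<subseteq> U" "U \<subseteq> ball 0 (real n)"
        "\<And>z x. z \<in> frontier U \<Longrightarrow> x \<in> cball z (1 / real n) \<Longrightarrow> t \<le> apply_cfun f x"
      unfolding barrier_def by blast
    \<comment> \<open>The frontier of \<open>U\<close> lies in the closed ball of radius
      \<open>n\<close>, and its neighbourhood adds at most 1; for \<open>n = 0\<close> the quotient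
      \<open>1 / real n\<close> is 0, so this still holds.\<close>
    have "t - e \<le> apply_cfun g x" if z: "z \<in> frontier U" and x: "x \<in> cball z (1 / real n)" for z x
    proof -
      have "closure U \<subseteq> cball 0 (real n)"
        using U(2) by (intro closure_minimal) auto
      then have "norm z \<le> real n"
        using z by (auto simp: frontier_def)
      moreover have "dist z x \<le> 1"
      proof -
        have "1 / real n \<le> 1" by (cases n) (auto simp: field_simps)
        then show ?thesis using x by simp
      qed
      ultimately have "x \<in> cball 0 (real n + 1)"
        using norm_triangle_ineq2[of x z] by (simp add: dist_norm norm_minus_commute)
      then show ?thesis using U(3)[OF z x] fg[of x] by linarith
    qed
    then have "barrier n (t - e) g"
      unfolding barrier_def using U(1,2) by blast
    then show ?thesis
      using False t e by (intro barrier_height_ge) auto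
  qed
  then show "barrier_height n f \<le> barrier_height n g + e"
    unfolding barrier_height_def[of n f]
    by (intro cSup_least[OF barrier_levels_nonempty]) (simp add: diff_le_eq)
qed

text \<open>The component of the origin itself serves as \<open>U\<close>. On its compact frontier
  \<open>f\<close> is at least \<open>a\<close>, so \<open>f\<close> exceeds \<open>a / 2\<close> on
  a uniform neighbourhood; a large \<open>n\<close> fits the neighbourhood, the inner ball and the
  outer ball.\<close>

lemma eventually_barrier:
  fixes f :: "'a::euclidean_space cfun"
  assumes f0: "apply_cfun f 0 < a" and a: "0 < a"
    and bdd: "bounded (connected_component_set {x. apply_cfun f x < a} 0)"
  shows "eventually (\<lambda>n. barrier n (a / 2) f) sequentially"
proof -
  define S where "S = {x. apply_cfun f x < a}"
  define U where "U = connected_component_set S 0"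
  have "open S"
    unfolding S_def by (intro open_Collect_less continuous_on_apply_cfun continuous_on_const)
  then have "open U" unfolding U_def by (rule open_connected_component)
  moreover have "0 \<in> U"
    using f0 by (simp add: U_def S_def)
  ultimately obtain r where r: "0 < r" "ball 0 r \<subseteq> U"
    using openE by blast
  obtain R where R: "U \<subseteq> ball 0 R"
    using bdd bounded_subset_ballD[of U 0] unfolding U_def S_def by blast
  \<comment> \<open>As \<open>S\<close> is open, its frontier avoids \<open>S\<close>, which gives
    \<open>f \<ge> a\<close> there.\<close>
  have "frontier U \<subseteq> frontier S"
    unfolding U_def by (rule frontier_of_connected_component_subset)
  moreover have "frontier S \<inter> S = {}"
    using \<open>open S\<close> by (simp add: frontier_def interior_open) blast
  ultimately have "frontier U \<subseteq> {x. a / 2 < apply_cfun f x}"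
    using a by (force simp: S_def)
  moreover have "open {x. a / 2 < apply_cfun f x}"
    by (intro open_Collect_less continuous_on_apply_cfun continuous_on_const)
  moreover have "compact (frontier U)"
    using bdd unfolding U_def S_def by (rule compact_frontier_bounded)
  ultimately obtain d where d: "0 < d" "(\<Union>x\<in>frontier U. ball x d) \<subseteq> {x. a / 2 < apply_cfun f x}"
    using compact_subset_open_imp_ball_epsilon_subset by metis
  have "eventually (\<lambda>n. 1 / real n < r) sequentially" "eventually (\<lambda>n. 1 / real n < d) sequentially"
    using r(1) d(1) by real_asymp+
  moreover have "eventually (\<lambda>n. R \<le> real n) sequentially"
    by real_asymp
  ultimately show ?thesis
  proof eventually_elim
    case (elim n)
    show ?case
      unfolding barrier_def
    proof (intro exI[of _ U] conjI ballI)
      show "ball 0 (1 / real n) \<subseteq> U"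
        using elim(1) r(2) by (meson less_imp_le subset_ball subset_trans)
      show "U \<subseteq> ball 0 (real n)"
        using elim(3) R by (meson subset_ball subset_trans)
      fix z x assume "z \<in> frontier U" "x \<in> cball z (1 / real n)"
      then have "x \<in> (\<Union>x\<in>frontier U. ball x d)"
        using elim(2) by force
      then show "a / 2 \<le> apply_cfun f x"
        using subsetD[OF d(2)] by fastforce
    qed
  qed
qed

text \<open>A continuous minorant of the indicator function of \<open>{f. barrier n (1 / real n) f}\<close>.\<close>

definition barrier_test :: "nat \<Rightarrow> 'a::euclidean_space cfun \<Rightarrow> real" where
  "barrier_test n f = max 0 (min 1 (real n * barrier_height n f - 1))"

lemma barrier_test_bounds: "0 \<le> barrier_test n f" "barrier_test n f \<le> 1"
  by (auto simp: barrier_test_def)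

lemma continuous_on_barrier_test:
  "continuous_on UNIV (barrier_test n :: 'a::euclidean_space cfun \<Rightarrow> real)"
  unfolding barrier_test_def[abs_def]
  by (intro continuous_intros continuous_on_barrier_height)

lemma barrier_of_test:
  assumes "0 < barrier_test n f"
  shows "0 < n" "barrier n (1 / real n) f"
proof -
  have *: "1 < real n * barrier_height n f"
    using assms by (auto simp: barrier_test_def max_def min_def split: if_splits)
  then show "0 < n" by (cases n) auto
  then show "barrier n (1 / real n) f"
    using * by (intro barrier_of_height) (auto simp: field_simps)
qed

text \<open>The height eventually stays above a fixed \<open>t\<close>, so the test saturates at 1
  as soon as \<open>real n * t \<ge> 2\<close>. Heights are capped at 1, hence the minimum in
  \<open>t\<close>.\<close>

lemma barrier_test_tendsto_1:
  fixes f :: "'a::euclidean_space cfun"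
  assumes "apply_cfun f 0 < a" "0 < a"
    and "bounded (connected_component_set {x. apply_cfun f x < a} 0)"
  shows "(\<lambda>n. barrier_test n f) \<longlonglongrightarrow> 1"
proof (rule tendsto_eventually)
  define t where "t = min 1 (a / 2)"
  have t: "0 < t" "t \<le> 1" using assms(2) by (auto simp: t_def)
  have "eventually (\<lambda>n. 2 / t \<le> real n) sequentially"
    by real_asymp
  then show "eventually (\<lambda>n. barrier_test n f = 1) sequentially"
    using eventually_barrier[OF assms]
  proof eventually_elim
    case (elim n)
    have "barrier n t f"
      using elim(2) by (rule barrier_antimono) (simp add: t_def)
    then have "t \<le> barrier_height n f"
      using t by (intro barrier_height_ge) auto
    then have "real n * t \<le> real n * barrier_height n f"
      by (rule mult_left_mono) simp
    moreover have "2 \<le> real n * t"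
      using elim(1) t by (simp add: field_simps)
    ultimately show ?case
      by (simp add: barrier_test_def)
  qed
qed

section \<open>Barriers at infinitely many scales\<close>

text \<open>Rescaling keeps the value 0 at the origin, and the bounded continuous test
  \<open>min 1 \<bar>f 0\<bar>\<close> carries this to the limit. It places the origin in
  \<open>{x. W x < a}\<close>; otherwise its component would be empty and boundedness would say
  nothing.\<close>

lemma AE_apply_cfun_0_of_converges_in_law:
  fixes M :: "'w measure" and V W :: "'w \<Rightarrow> 'a::real_normed_vector cfun"
  assumes "prob_space M" and W: "W \<in> borel_measurable M"
    and V0: "AE \<omega> in M. apply_cfun (V \<omega>) 0 = 0"
    and law: "converges_in_law M (\<lambda>l \<omega>. rescale \<alpha> l (V \<omega>)) W at_top"
  shows "AE \<omega> in M. apply_cfun (W \<omega>) 0 = 0"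
proof -
  interpret prob_space M by fact
  define \<phi> where "\<phi> f = min 1 \<bar>apply_cfun f (0::'a)\<bar>" for f
  have cont: "continuous_on UNIV \<phi>"
  proof (rule continuous_on_cfunI)
    show "compact {0::'a}" by simp
  qed (force simp: \<phi>_def)
  have bdd: "bounded (range \<phi>)"
    by (rule boundedI[of _ 1]) (auto simp: \<phi>_def)
  have "((\<lambda>l. \<integral>\<omega>. \<phi> (rescale \<alpha> l (V \<omega>)) \<partial>M) \<longlongrightarrow> (\<integral>\<omega>. \<phi> (W \<omega>) \<partial>M)) at_top"
    using law cont bdd by (simp add: converges_in_law_def)
  moreover have "(\<integral>\<omega>. \<phi> (rescale \<alpha> l (V \<omega>)) \<partial>M) = 0" for l
    by (rule integral_eq_zero_AE) (use V0 in \<open>auto simp: \<phi>_def rescale.rep_eq elim: eventually_mono\<close>)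
  ultimately have "(\<integral>\<omega>. \<phi> (W \<omega>) \<partial>M) = 0"
    by (simp add: tendsto_const_iff)
  moreover have "(\<lambda>\<omega>. \<phi> (W \<omega>)) \<in> borel_measurable M"
    using W borel_measurable_continuous_onI[OF cont] by (rule measurable_compose)
  then have "integrable M (\<lambda>\<omega>. \<phi> (W \<omega>))"
    by (rule integrable_const_bound[where B = 1, rotated]) (auto simp: \<phi>_def)
  ultimately have "AE \<omega> in M. \<phi> (W \<omega>) = 0"
    by (subst (asm) integral_nonneg_eq_0_iff_AE) (auto simp: \<phi>_def)
  then show ?thesis
    by eventually_elim (auto simp: \<phi>_def min_def split: if_splits)
qed

text \<open>For fixed \<open>n\<close>, having no barrier at all large scales has probability at
  most \<open>1 - expectation (\<lambda>\<omega>. barrier_test n (W \<omega>))\<close>, which tends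
  to 0 as \<open>n\<close> grows. So almost surely some \<open>n\<close>, depending on the
  environment, has barriers infinitely often. Natural scales suffice and keep the events
  countable.\<close>

lemma AE_frequently_barrier:
  fixes M :: "'w measure" and V W :: "'w \<Rightarrow> 'a::euclidean_space cfun"
  assumes "prob_space M" and V: "V \<in> borel_measurable M" and W: "W \<in> borel_measurable M"
    and V0: "AE \<omega> in M. apply_cfun (V \<omega>) 0 = 0"
    and law: "converges_in_law M (\<lambda>l \<omega>. rescale \<alpha> l (V \<omega>)) W at_top"
    and bdd: "AE \<omega> in M. \<exists>a>0. bounded (connected_component_set {x. apply_cfun (W \<omega>) x < a} 0)"
  shows "AE \<omega> in M. \<exists>n>0. \<exists>\<^sub>F l :: nat in sequentially.
    barrier n (1 / real n) (rescale \<alpha> (real l) (V \<omega>))"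
proof -
  interpret prob_space M by fact
  define T where "T n l \<omega> = barrier_test n (rescale \<alpha> (real l) (V \<omega>))" for n l \<omega>
  have meas_test: "barrier_test n \<in> borel_measurable borel" for n
    by (rule borel_measurable_continuous_onI[OF continuous_on_barrier_test])
  have meas_T [measurable]: "T n l \<in> borel_measurable M" for n l
    unfolding T_def
    by (intro measurable_compose[OF _ meas_test] measurable_compose[OF V]
        borel_measurable_continuous_onI continuous_on_rescale)
  have meas_W [measurable]: "(\<lambda>\<omega>. barrier_test n (W \<omega>)) \<in> borel_measurable M" for n
    by (rule measurable_compose[OF W meas_test])
  have int_T [intro]: "integrable M (T n l)" for n l
    by (rule integrable_const_bound[where B = 1]) (auto simp: T_def barrier_test_bounds)
  have lim: "(\<lambda>l. expectation (T n l)) \<longlonglongrightarrow> expectation (\<lambda>\<omega>. barrier_test n (W \<omega>))" for n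
  proof -
    have "bounded (range (barrier_test n :: 'a cfun \<Rightarrow> real))"
      by (rule boundedI[of _ 1]) (auto simp: barrier_test_bounds)
    then have "((\<lambda>l. \<integral>\<omega>. barrier_test n (rescale \<alpha> l (V \<omega>)) \<partial>M) \<longlongrightarrow>
        (\<integral>\<omega>. barrier_test n (W \<omega>) \<partial>M)) at_top"
      using law continuous_on_barrier_test unfolding converges_in_law_def by blast
    then show ?thesis
      unfolding T_def by (rule filterlim_compose) (rule filterlim_real_sequentially)
  qed
  have "AE \<omega> in M. (\<lambda>n. barrier_test n (W \<omega>)) \<longlonglongrightarrow> 1"
    using bdd AE_apply_cfun_0_of_converges_in_law[OF \<open>prob_space M\<close> W V0 law]
    by eventually_elim (auto intro: barrier_test_tendsto_1)
  then have "(\<lambda>n. expectation (\<lambda>\<omega>. barrier_test n (W \<omega>))) \<longlonglongrightarrow> expectation (\<lambda>_. 1)"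
    by (intro integral_dominated_convergence[where w = "\<lambda>_. 1"]) (auto simp: barrier_test_bounds)
  then have lim1: "(\<lambda>n. 1 - expectation (\<lambda>\<omega>. barrier_test n (W \<omega>))) \<longlonglongrightarrow> 0"
    using tendsto_diff[OF tendsto_const[of 1]] by (fastforce simp: prob_space)
  \<comment> \<open>On \<open>C n m\<close> the test sees no barrier at any scale from
    \<open>m\<close> on; the sets increase with \<open>m\<close>.\<close>
  define C where "C n m = {\<omega> \<in> space M. \<forall>l\<ge>m. T n l \<omega> = 0}" for n m :: nat
  have meas_C [measurable]: "C n m \<in> events" for n m
    unfolding C_def by measurable
  have prob_C: "prob (C n m) \<le> 1 - expectation (\<lambda>\<omega>. barrier_test n (W \<omega>))" for n m
  proof (rule LIMSEQ_le_const)
    show "(\<lambda>l. 1 - expectation (T n l)) \<longlonglongrightarrow> 1 - expectation (\<lambda>\<omega>. barrier_test n (W \<omega>))"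
      by (intro tendsto_intros lim)
    have "prob (C n m) \<le> 1 - expectation (T n l)" if "m \<le> l" for l
    proof -
      have "prob (C n m) = expectation (indicator (C n m))"
        by simp
      \<comment> \<open>On \<open>C n m\<close> the test is 0, and off it the test is at most
        1.\<close>
      also have "\<dots> \<le> expectation (\<lambda>\<omega>. 1 - T n l \<omega>)"
      proof (rule integral_mono)
        show "indicator (C n m) \<omega> \<le> 1 - T n l \<omega>" for \<omega>
          using that barrier_test_bounds[of n "rescale \<alpha> (real l) (V \<omega>)"]
          by (auto simp: C_def T_def indicator_def)
      qed (auto simp: less_top[symmetric])
      also have "\<dots> = 1 - expectation (T n l)"
        using int_T by (simp add: prob_space)
      finally show ?thesis .
    qed
    then show "\<exists>N. \<forall>l\<ge>N. prob (C n m) \<le> 1 - expectation (T n l)" by blast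
  qed
  have prob_UN: "prob (\<Union>m. C n m) \<le> 1 - expectation (\<lambda>\<omega>. barrier_test n (W \<omega>))" for n
  proof (rule LIMSEQ_le_const2)
    show "(\<lambda>m. prob (C n m)) \<longlonglongrightarrow> prob (\<Union>m. C n m)"
      by (intro finite_Lim_measure_incseq) (auto simp: incseq_def C_def)
  qed (use prob_C in auto)
  \<comment> \<open>This event lies in the union over \<open>m\<close> for each single
    \<open>n\<close>, so the bound may be sent to its limit in \<open>n\<close>.\<close>
  have "prob (\<Inter>n. \<Union>m. C n m) \<le> 0"
  proof (rule LIMSEQ_le_const[OF lim1])
    have "prob (\<Inter>n. \<Union>m. C n m) \<le> prob (\<Union>m. C n m)" for n
      by (rule finite_measure_mono) auto
    then show "\<exists>N. \<forall>n\<ge>N. prob (\<Inter>n. \<Union>m. C n m) \<le> 1 - expectation (\<lambda>\<omega>. barrier_test n (W \<omega>))"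
      using prob_UN order_trans by blast
  qed
  then have "prob (\<Inter>n. \<Union>m. C n m) = 0"
    by (rule antisym) (rule measure_nonneg)
  then have "AE \<omega> in M. \<omega> \<notin> (\<Inter>n. \<Union>m. C n m)"
    by (intro AE_not_in) (auto simp: null_sets_def emeasure_eq_measure)
  then show ?thesis
    using AE_space
  proof eventually_elim
    case (elim \<omega>)
    then obtain n where "\<And>m. \<omega> \<notin> C n m" by blast
    then have "\<exists>\<^sub>F l in sequentially. T n l \<omega> \<noteq> 0"
      using elim(2) by (auto simp: C_def frequently_sequentially)
    then have "\<exists>\<^sub>F l in sequentially. 0 < T n l \<omega>"
      by (rule frequently_elim1) (simp add: T_def order.strict_iff_order barrier_test_bounds)
    then have "\<exists>\<^sub>F l in sequentially. 0 < n \<and> barrier n (1 / real n) (rescale \<alpha> (real l) (V \<omega>))"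
      by (rule frequently_elim1) (simp add: T_def barrier_of_test)
    then show ?case by auto
  qed
qed

section \<open>From continuum barriers to finite lattice sets with light boundary\<close>

lemma finite_int_box: "finite {y :: int ^ 'd::finite. \<forall>i. \<bar>y $ i\<bar> \<le> int m}" (is ?A)
  and card_int_box: "card {y :: int ^ 'd::finite. \<forall>i. \<bar>y $ i\<bar> \<le> int m} \<le> (2 * m + 1) ^ CARD('d)" (is ?B)
proof -
  let ?P = "PiE (UNIV :: 'd set) (\<lambda>_. {- int m..int m})"
  have eq: "{y :: int ^ 'd. \<forall>i. \<bar>y $ i\<bar> \<le> int m} \<subseteq> vec_lambda ` ?P"
  proof
    fix y :: "int ^ 'd" assume "y \<in> {y. \<forall>i. \<bar>y $ i\<bar> \<le> int m}"
    then have "vec_nth y \<in> ?P" by (auto simp: abs_le_iff PiE_iff) (smt (verit))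
    then show "y \<in> vec_lambda ` ?P" by (metis imageI vec_nth_inverse)
  qed
  have fin: "finite ?P" by (intro finite_PiE) auto
  then show ?A using eq finite_subset by blast
  have "card {y :: int ^ 'd. \<forall>i. \<bar>y $ i\<bar> \<le> int m} \<le> card (vec_lambda ` ?P)"
    using eq fin by (intro card_mono) auto
  also have "\<dots> \<le> card ?P" by (rule card_image_le[OF fin])
  also have "\<dots> = (2 * m + 1) ^ CARD('d)"
    by (simp add: card_PiE nat_add_distrib nat_mult_distrib)
  finally show ?B .
qed

text \<open>The lattice points whose scaled image lies in \<open>U\<close> form \<open>A\<close>,
  and their outer neighbours form \<open>B\<close>. The number of points of \<open>B\<close> is
  polynomial in \<open>l\<close>, while each has mass at most
  \<open>exp (- (l powr \<alpha> / n))\<close>.\<close>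

lemma recurrent_walk_of_barriers:
  fixes K :: "int ^ 'd::finite \<Rightarrow> (int ^ 'd) pmf" and V :: "(real ^ 'd) cfun"
  assumes inv: "invariant_measure K \<mu>" and nn: "nearest_neighbor K"
    and \<mu>: "\<And>x. \<mu> x = exp (- apply_cfun V (lattice_pt x))"
    and "0 < \<alpha>" "0 < n"
    and barriers: "\<exists>\<^sub>F l :: nat in sequentially. barrier n (1 / real n) (rescale \<alpha> (real l) V)"
  shows "recurrent_walk K"
proof (rule recurrent_walkI[OF inv])
  fix x :: "int ^ 'd" and e :: real
  assume "0 < e"
  have n: "0 < real n" using \<open>0 < n\<close> by simp
  \<comment> \<open>The power is the cardinality bound \<open>(2 * m + 1) ^ CARD('d)\<close> for the
    box with \<open>m = l * n + 1\<close>.\<close>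
  have "((\<lambda>l. (2 * (l * real n + 1) + 1) ^ CARD('d) * exp (- (l powr \<alpha> / real n))) \<longlongrightarrow> 0) at_top"
    using n \<open>0 < \<alpha>\<close> by real_asymp
  then have "(\<lambda>l. (2 * (real l * real n + 1) + 1) ^ CARD('d) * exp (- (real l powr \<alpha> / real n))) \<longlonglongrightarrow> 0"
    by (rule filterlim_compose) (rule filterlim_real_sequentially)
  then have "eventually (\<lambda>l. (2 * (real l * real n + 1) + 1) ^ CARD('d) * exp (- (real l powr \<alpha> / real n)) < e) sequentially"
    using \<open>0 < e\<close> by (rule order_tendstoD)
  \<comment> \<open>The first condition brings the scaled \<open>x\<close> into the inner ball of
    radius \<open>1 / n\<close>; the second makes a scaled lattice step, of length
    \<open>1 / l\<close>, no longer than the width \<open>1 / n\<close> of the barrier.\<close>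
  moreover have "eventually (\<lambda>l. real n * norm (lattice_pt x) < real l) sequentially"
    "eventually (\<lambda>l. real n \<le> real l) sequentially"
    by real_asymp+
  ultimately have "\<forall>\<^sub>F l in sequentially.
      (2 * (real l * real n + 1) + 1) ^ CARD('d) * exp (- (real l powr \<alpha> / real n)) < e \<and>
      real n * norm (lattice_pt x) < real l \<and> real n \<le> real l"
    by eventually_elim simp
  then obtain l where bar: "barrier n (1 / real n) (rescale \<alpha> (real l) V)"
    and small: "(2 * (real l * real n + 1) + 1) ^ CARD('d) * exp (- (real l powr \<alpha> / real n)) < e"
    and lx: "real n * norm (lattice_pt x) < real l" and ln: "real n \<le> real l"
    using frequently_ex[OF frequently_eventually_conj[OF barriers]] by blast
  have l: "0 < real l" using n ln by linarith
  obtain U :: "(real ^ 'd) set" where U: "ball 0 (1 / real n) \<subseteq> U" "U \<subseteq> ball 0 (real n)"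
    "\<And>z w. z \<in> frontier U \<Longrightarrow> w \<in> cball z (1 / real n) \<Longrightarrow> 1 / real n \<le> apply_cfun (rescale \<alpha> (real l) V) w"
    using bar unfolding barrier_def by blast
  define s where "s z = (1 / real l) *\<^sub>R lattice_pt z" for z :: "int ^ 'd"
  define A where "A = {z. s z \<in> U}"
  \<comment> \<open>\<open>A\<close> has radius at most \<open>l * n\<close>, and the extra 1 makes
    room for its neighbours.\<close>
  define m where "m = l * n + 1"
  let ?box = "{y :: int ^ 'd. \<forall>i. \<bar>y $ i\<bar> \<le> int m}"
  define B where "B = {y \<in> ?box - A. \<exists>z\<in>A. norm (lattice_pt z - lattice_pt y) = 1}"
  have box: "y \<in> ?box" if "norm (lattice_pt y) \<le> real m" for y :: "int ^ 'd"
  proof -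
    have "\<bar>y $ i\<bar> \<le> int m" for i
    proof -
      have "\<bar>lattice_pt y $ i\<bar> \<le> real m"
        using component_le_norm_cart[of "lattice_pt y" i] that by linarith
      then show ?thesis by (simp add: lattice_pt_def flip: of_int_abs)
    qed
    then show ?thesis by simp
  qed
  have A_norm: "norm (lattice_pt z) \<le> real (l * n)" if "z \<in> A" for z
  proof -
    have "norm (s z) < real n" using that U(2) by (auto simp: A_def)
    then show ?thesis using l by (simp add: s_def field_simps)
  qed
  have "A \<subseteq> ?box"
    using A_norm by (intro subsetI box) (force simp: m_def)
  then have "finite A" by (rule finite_subset[OF _ finite_int_box])
  moreover have finB: "finite B"
    unfolding B_def by (rule finite_subset[OF _ finite_int_box[of m]]) blast
  moreover have "x \<in> A"
  proof -
    have "norm (s x) < 1 / real n"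
      using lx l n by (simp add: s_def field_simps)
    then show ?thesis using U(1) by (auto simp: A_def)
  qed
  moreover have "\<forall>z\<in>A. set_pmf (K z) \<subseteq> A \<union> B"
  proof (intro ballI subsetI)
    fix z y assume z: "z \<in> A" and "y \<in> set_pmf (K z)"
    then have 1: "norm (lattice_pt z - lattice_pt y) = 1"
      using nn by (simp add: nearest_neighbor_def pmf_positive)
    have "norm (lattice_pt y) \<le> real m"
      using A_norm[OF z] norm_triangle_ineq2[of "lattice_pt y" "lattice_pt z"] 1
      by (simp add: m_def norm_minus_commute)
    then show "y \<in> A \<union> B"
      using box z 1 by (auto simp: B_def)
  qed
  moreover have "(\<Sum>y\<in>B. \<mu> y) \<le> e"
  proof -
    have "\<mu> y \<le> exp (- (real l powr \<alpha> / real n))" if "y \<in> B" for y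
    proof -
      obtain z where z: "z \<in> A" "norm (lattice_pt z - lattice_pt y) = 1" and "y \<notin> A"
        using \<open>y \<in> B\<close> by (auto simp: B_def)
      \<comment> \<open>A step leaving \<open>A\<close> crosses the frontier of \<open>U\<close> at
        a point within \<open>1 / l\<close> of \<open>s y\<close>, so the lower bound around the
        frontier reaches the lattice point itself.\<close>
      have "closed_segment (s z) (s y) \<inter> frontier U \<noteq> {}"
        using z(1) \<open>y \<notin> A\<close> by (intro connected_Int_frontier) (auto simp: A_def)
      then obtain w where w: "w \<in> closed_segment (s z) (s y)" "w \<in> frontier U" by blast
      have "dist w (s y) \<le> dist (s z) (s y)"
        using dist_in_closed_segment[OF w(1)] by simp
      also have "\<dots> = 1 / real l"
        using z(2) l by (simp add: s_def dist_norm flip: scaleR_diff_right)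
      also have "\<dots> \<le> 1 / real n"
        using n ln by (simp add: frac_le)
      finally have "1 / real n \<le> apply_cfun (rescale \<alpha> (real l) V) (s y)"
        using U(3)[OF w(2)] by simp
      also have "\<dots> = apply_cfun V (lattice_pt y) / real l powr \<alpha>"
        using l by (simp add: rescale.rep_eq s_def powr_minus divide_inverse mult.commute)
      finally have "real l powr \<alpha> / real n \<le> apply_cfun V (lattice_pt y)"
        using l by (simp add: pos_le_divide_eq)
      then show ?thesis by (simp add: \<mu>)
    qed
    then have "(\<Sum>y\<in>B. \<mu> y) \<le> real (card B) * exp (- (real l powr \<alpha> / real n))"
      by (rule sum_bounded_above)
    also have "card B \<le> (2 * m + 1) ^ CARD('d)"
      using card_int_box[of m, where 'd = 'd] card_mono[OF finite_int_box[of m], of B] by (force simp: B_def)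
    then have "real (card B) * exp (- (real l powr \<alpha> / real n)) \<le>
        (2 * (real l * real n + 1) + 1) ^ CARD('d) * exp (- (real l powr \<alpha> / real n))"
      unfolding m_def by (intro mult_right_mono) (auto simp flip: of_nat_le_iff[where 'a = real])
    finally show ?thesis using small by linarith
  qed
  ultimately show "\<exists>A B. finite A \<and> finite B \<and> x \<in> A \<and>
      (\<forall>z\<in>A. set_pmf (K z) \<subseteq> A \<union> B) \<and> (\<Sum>y\<in>B. \<mu> y) \<le> e"
    by blast
qed

theorem lemma5p4:
  fixes M :: "'w measure"
    and p :: "'w \<Rightarrow> int ^ 'd::finite \<Rightarrow> (int ^ 'd) pmf"
    and \<mu> :: "'w \<Rightarrow> int ^ 'd \<Rightarrow> real"
    and V W :: "'w \<Rightarrow> (real ^ 'd) cfun"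
    and \<alpha> :: real
  assumes "prob_space M"
    and "\<And>x y. (\<lambda>\<omega>. pmf (p \<omega> x) y) \<in> borel_measurable M"
    and "AE \<omega> in M. irreducible_walk (p \<omega>)"
    and "AE \<omega> in M. nearest_neighbor (p \<omega>)"
    and "\<And>x. (\<lambda>\<omega>. \<mu> \<omega> x) \<in> borel_measurable M"
    and "AE \<omega> in M. invariant_measure (p \<omega>) (\<mu> \<omega>)"
    and "V \<in> borel_measurable M"
    and "AE \<omega> in M. \<forall>x. \<mu> \<omega> x = exp (- apply_cfun (V \<omega>) (lattice_pt x))"
    and "AE \<omega> in M. apply_cfun (V \<omega>) 0 = 0"
    and "\<alpha> > 0"
    and "W \<in> borel_measurable M"
    and "converges_in_law M (\<lambda>l \<omega>. rescale \<alpha> l (V \<omega>)) W at_top"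
    and "AE \<omega> in M. \<exists>a>0. bounded (connected_component_set {x. apply_cfun (W \<omega>) x < a} 0)"
  shows "AE \<omega> in M. recurrent_walk (p \<omega>)"
proof -
  \<comment> \<open>This is the only probabilistic input over environments; with the barriers given,
    recurrence is deduced for each environment separately.\<close>
  have "AE \<omega> in M. \<exists>n>0. \<exists>\<^sub>F l :: nat in sequentially.
      barrier n (1 / real n) (rescale \<alpha> (real l) (V \<omega>))"
    by (rule AE_frequently_barrier[OF assms(1,7,11,9,12,13)])
  then show ?thesis
    using assms(4,6,8)
  proof eventually_elim
    case (elim \<omega>)
    then show ?case
      using recurrent_walk_of_barriers[of "p \<omega>" "\<mu> \<omega>" "V \<omega>" \<alpha>] \<open>\<alpha> > 0\<close> by blast
  qed
qed

end
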